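(* Let $a$ and $c$ be real numbers with $a > 1$ and $c > 0$. Let $R(1,c,a)$ denote the (discrete) 2-color Rado number for the equation $x_1 + c = a x_0$. Then $$R(1,c,a) = \begin{cases} \frac{c}{a-1} & \text{if } (a-1) \mid c,\\ \infty & \text{otherwise,}\end{cases}$$ where $(a-1)\mid c$ means that $\frac{c}{a-1}$ is an integer.
   Context: The (discrete) 2-color Rado number $R(1,c,a)$ is the smallest positive integer $R$ such that for every coloring of the integers in $\{1,2,\dots,R\}$ with two colors there exist $x_1,x_0 \in \{1,\dots,R\}$ (not necessarily distinct) of the same color with $x_1 + c = a x_0$ (a monochromatic solution). If no such $R$ exists, then $R(1,c,a)=\infty$. *)

theory Defs
  imports Complex_Main "HOL-Library.Extended_Real"
begin

text \<open>A 2-coloring of \<open>{1..R}\<close> is given by a function \<open>nat \<Rightarrow> bool\<close>, of which only the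
  values on \<open>{1..R}\<close> matter. The solution may have \<open>x1 = x0\<close>.\<close>

definition rado_property :: "real \<Rightarrow> real \<Rightarrow> nat \<Rightarrow> bool" where
  "rado_property c a R \<longleftrightarrow>
     (\<forall>\<chi> :: nat \<Rightarrow> bool. \<exists>x1 \<in> {1..R}. \<exists>x0 \<in> {1..R}.
        \<chi> x1 = \<chi> x0 \<and> real x1 + c = a * real x0)"

definition rado_number :: "real \<Rightarrow> real \<Rightarrow> enat" where
  "rado_number c a =
     (if \<exists>R \<ge> 1. rado_property c a R
      then enat (LEAST R. R \<ge> 1 \<and> rado_property c a R)
      else \<infinity>)"

end

theory Submission
  imports Defs
begin

text \<open>The map \<open>x \<mapsto> a x - c\<close> is the dilation by \<open>a\<close> about its fixed point \<open>t = c / (a - 1)\<close>.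
  If \<open>t\<close> is one of the colored integers, then \<open>x1 = x0 = t\<close> is a monochromatic solution. Otherwise
  color \<open>x\<close> by the parity of \<open>\<lfloor>log a \<bar>x - t\<bar>\<rfloor>\<close>: the dilation raises this floor by exactly one,
  so no solution is monochromatic.\<close>

lemma rado_solution_iff_dilation:
  fixes a c x y :: real
  assumes "a > 1"
  shows "y + c = a * x \<longleftrightarrow> y - c / (a - 1) = a * (x - c / (a - 1))"
proof -
  define t where "t = c / (a - 1)"
  have "t * (a - 1) = c"
    using assms by (simp add: t_def)
  then have "c = a * t - t"
    by (simp add: algebra_simps)
  then show ?thesis
    unfolding t_def[symmetric] by (auto simp: algebra_simps)
qed

text \<open>The case \<open>u = 0\<close> must be excluded: there both logarithms have the same
  argument.\<close>

lemma floor_log_dilation: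
  fixes a u :: real
  assumes "a > 1" and "u \<noteq> 0"
  shows "\<lfloor>log a \<bar>a * u\<bar>\<rfloor> = \<lfloor>log a \<bar>u\<bar>\<rfloor> + 1"
proof -
  have "log a \<bar>a * u\<bar> = log a \<bar>u\<bar> + 1"
    using assms by (simp add: abs_mult log_mult)
  then show ?thesis by simp
qed

lemma rado_property_iff:
  fixes a c :: real
  assumes "a > 1"
  shows "rado_property c a R \<longleftrightarrow> (\<exists>n\<in>{1..R}. real n = c / (a - 1))"
proof
  assume *: "rado_property c a R"
  define t where "t = c / (a - 1)"
  obtain x1 x0 where x: "x0 \<in> {1..R}" "real x1 + c = a * real x0"
    and same: "even \<lfloor>log a \<bar>real x1 - t\<bar>\<rfloor> = even \<lfloor>log a \<bar>real x0 - t\<bar>\<rfloor>"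
    using *[unfolded rado_property_def, rule_format, of "\<lambda>x. even \<lfloor>log a \<bar>real x - t\<bar>\<rfloor>"]
    by blast
  have "real x1 - t = a * (real x0 - t)"
    using x(2) rado_solution_iff_dilation[OF assms] by (simp add: t_def)
  \<comment> \<open>Were \<open>x0\<close> different from \<open>t\<close>, the two floors would
    differ by one and have opposite parities.\<close>
  with same have "real x0 = t"
    using floor_log_dilation[OF assms, of "real x0 - t"] by fastforce
  with x(1) show "\<exists>n\<in>{1..R}. real n = c / (a - 1)"
    by (auto simp: t_def)
next
  assume "\<exists>n\<in>{1..R}. real n = c / (a - 1)"
  then obtain n where n: "n \<in> {1..R}" "real n = c / (a - 1)" by blast
  \<comment> \<open>Here \<open>n\<close> is the center of the dilation, so both sides of its
    equation vanish.\<close>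
  then have "real n + c = a * real n"
    using rado_solution_iff_dilation[OF assms, of "real n" c "real n"] by simp
  with n(1) show "rado_property c a R"
    unfolding rado_property_def by blast
qed

theorem mainTheorem3:
  fixes a c :: real
  assumes "a > 1" and "c > 0"
  shows "ereal_of_enat (rado_number c a) =
    (if c / (a - 1) \<in> \<int> then ereal (c / (a - 1)) else \<infinity>)"
proof (cases "c / (a - 1) \<in> \<int>")
  case True
  \<comment> \<open>Positivity makes the integer quotient a natural number that is at least
    1.\<close>
  have pos: "c / (a - 1) > 0"
    using assms by simp
  with True obtain n :: nat where n: "c / (a - 1) = real n"
    by (metis Ints_cases of_int_0_less_iff of_int_of_nat_eq zero_less_imp_eq_int)
  \<comment> \<open>The intervals that contain \<open>n\<close> are those with R \<ge> n, so the
    least one ends at \<open>n\<close>.\<close>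
  have rado: "rado_property c a R \<longleftrightarrow> n \<in> {1..R}" for R
    using rado_property_iff[OF assms(1), of c R] n by auto
  have "n \<ge> 1"
    using pos n by simp
  then have "(LEAST R. R \<ge> 1 \<and> rado_property c a R) = n"
    by (intro Least_equality) (auto simp: rado)
  moreover have "\<exists>R\<ge>1. rado_property c a R"
    using \<open>n \<ge> 1\<close> rado by auto
  ultimately show ?thesis
    using True n by (simp add: rado_number_def)
next
  case False
  then have "\<not> rado_property c a R" for R
    unfolding rado_property_iff[OF assms(1)] by (metis Ints_of_nat)
  with False show ?thesis
    by (simp add: rado_number_def)
qed

end
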